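(* Let $X=\mathbb{R}^d$, $d\ge 2$, and let $p_1,\ldots,p_n\in X$, $n\ge 1$. Furthermore, let $\gamma_1,\ldots,\gamma_n$ be gauges on $X$, let $f:X\to\mathbb{R}$, $f(x)=\sum_{i=1}^n\gamma_i(p_i-x)$, let $\alpha\in\mathbb{R}$, and let $f_{\le\alpha}=\{x\in X:f(x)\le\alpha\}$. Then every point $x_0\in\mathrm{ext}_{d-2}(f_{\le\alpha})$ can be expressed as $x_0=p_i+\lambda w$ with suitable $i\in\{1,\ldots,n\}$, a real number $\lambda\in[0,\alpha]$, and a point $w\in\mathrm{ext}_{d-2}(-B_{\gamma_i}(0,1))$.
   Context: A gauge on $X$ is a function $\gamma:X\to[0,+\infty)$ such that $\gamma(x)=0$ implies $x=0$; $\gamma(\lambda x)=\lambda\gamma(x)$ for all $x\in X$, $\lambda\ge 0$; and $\gamma(x+y)\le\gamma(x)+\gamma(y)$ for all $x,y\in X$ (no symmetry is assumed). $B_\gamma(0,1)=\{x\in X:\gamma(x)\le 1\}$ is its unit ball. A $k$-face ($0\le k\le d$) of a closed convex set $K\subseteq\mathbb{R}^d$ is a convex subset $F\subseteq K$ of affine dimension $k$ such that, whenever a relative interior point of a line segment $[x,y]\subseteq K$ belongs to $F$, then $[x,y]\subseteq F$. Every $x\in K$ belongs to the relative interior of a unique face $F_x$ of $K$; $x$ is called $k$-extreme if $\dim(F_x)\le k$. $\mathrm{ext}_k(K)$ (the $k$-skeleton) is the set of all $k$-extreme points of $K$. *)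

theory Defs
  imports "HOL-Analysis.Analysis"
begin

text \<open>Unrelated to \<^const>\<open>gauge\<close>, which belongs to Henstock--Kurzweil integration:
  a possibly asymmetric norm.\<close>

definition gauge_fun :: "('a::real_vector \<Rightarrow> real) \<Rightarrow> bool" where
  "gauge_fun g \<longleftrightarrow>
     (\<forall>x. 0 \<le> g x) \<and>
     (\<forall>x. g x = 0 \<longrightarrow> x = 0) \<and>
     (\<forall>x. \<forall>l\<ge>0. g (l *\<^sub>R x) = l * g x) \<and>
     (\<forall>x y. g (x + y) \<le> g x + g y)"

definition gauge_ball :: "('a::real_vector \<Rightarrow> real) \<Rightarrow> 'a set" where
  "gauge_ball g = {x. g x \<le> 1}"

text \<open>\<^term>\<open>face_through K x\<close> is the face $F_x$; it is meaningful for convex \<open>K\<close> and \<open>x \<in> K\<close>,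
  see \<open>ex1_face_through\<close>. The relative interior of a degenerate segment \<open>[x, x]\<close> is \<open>{x}\<close> whereas
  \<^term>\<open>open_segment x x\<close> is empty, but the face condition is vacuous for such segments, so
  \<^const>\<open>face_of\<close> is the usual notion.\<close>

definition face_through :: "'a::euclidean_space set \<Rightarrow> 'a \<Rightarrow> 'a set" where
  "face_through K x = (THE F. F face_of K \<and> x \<in> rel_interior F)"

definition k_extreme :: "nat \<Rightarrow> 'a::euclidean_space set \<Rightarrow> 'a \<Rightarrow> bool" where
  "k_extreme k K x \<longleftrightarrow> x \<in> K \<and> aff_dim (face_through K x) \<le> int k"

definition skeleton :: "nat \<Rightarrow> 'a::euclidean_space set \<Rightarrow> 'a set" where
  "skeleton k K = {x. k_extreme k K x}"

lemma ex1_face_through: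
  fixes K :: "'a::euclidean_space set"
  assumes "convex K" "x \<in> K"
  shows "\<exists>!F. F face_of K \<and> x \<in> rel_interior F"
proof -
  define F where "F = \<Inter>{T. T face_of K \<and> x \<in> T}"
  have K: "K face_of K" using assms(1) by (rule face_of_refl)
  have F: "F face_of K"
    unfolding F_def using K assms(2) by (intro face_of_Inter) auto
  have xF: "x \<in> F" unfolding F_def by blast
  have "x \<in> rel_interior F"
  proof (rule ccontr)
    assume n: "x \<notin> rel_interior F"
    have cF: "convex F" using F by (rule face_of_imp_convex)
    have "x \<in> closure F" using xF closure_subset by blast
    obtain a where a: "\<And>y. y \<in> closure F \<Longrightarrow> a \<bullet> x \<le> a \<bullet> y"
      and a': "\<And>y. y \<in> rel_interior F \<Longrightarrow> a \<bullet> x < a \<bullet> y"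
      using supporting_hyperplane_relative_frontier[OF cF \<open>x \<in> closure F\<close> n] by metis
    have "(F \<inter> {y. a \<bullet> y = a \<bullet> x}) face_of F"
      using cF a closure_subset by (intro face_of_Int_supporting_hyperplane_ge) auto
    then have "(F \<inter> {y. a \<bullet> y = a \<bullet> x}) face_of K" using F face_of_trans by blast
    then have "F \<subseteq> {y. a \<bullet> y = a \<bullet> x}" unfolding F_def using xF F_def by blast
    moreover obtain y where "y \<in> rel_interior F"
      using cF xF rel_interior_eq_empty by blast
    ultimately show False using a' rel_interior_subset by fastforce
  qed
  with F show ?thesis using face_of_eq by blast
qed

end

theory Submission
  imports Defs
begin

text \<open>
  A point of a convex set fails to lie on the \<open>(d - 2)\<close>-skeleton exactly when the set contains a
  neighbourhood of the point in some hyperplane. For the unit ball of a gauge \<open>g\<close> this is a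
  statement about linearity: if \<open>y \<noteq> 0\<close> and the normalised point \<open>y / g y\<close> is off the skeleton, then
  the unit sphere is flat there, so \<open>g\<close> is linear near \<open>y\<close> (\<open>gauge_linear_near_non_skeleton\<close>).
  For a sublevel set the other implication is used: where the function is locally affine, the point
  is surrounded by a piece of the level hyperplane, so it is off the skeleton
  (\<open>locally_affine_not_skeleton\<close>).

  If \<open>x\<^sub>0 = p\<^sub>i\<close>, take the factor \<open>0\<close> and any skeleton point of \<open>- B\<^sub>i\<close>; an extreme point of this
  compact ball is one (\<open>skeleton_nonempty\<close>). Otherwise \<open>x\<^sub>0 - p\<^sub>i\<close> is, for every \<open>i\<close>, the multiple by
  \<open>\<gamma>\<^sub>i (p\<^sub>i - x\<^sub>0) \<le> f x\<^sub>0 \<le> \<alpha>\<close> of a boundary point of \<open>- B\<^sub>i\<close>. If none of these boundary points were on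
  its skeleton, each summand of \<open>f\<close> would be affine near \<open>x\<^sub>0\<close>, hence so would \<open>f\<close>, and \<open>x\<^sub>0\<close> would
  not be \<open>(d - 2)\<close>-extreme.
\<close>

section \<open>Faces and skeletons\<close>

lemma face_through:
  fixes K :: "'a::euclidean_space set"
  assumes "convex K" "x \<in> K"
  shows "face_through K x face_of K" "x \<in> rel_interior (face_through K x)"
  using theI'[OF ex1_face_through[OF assms]] unfolding face_through_def by auto

text \<open>A face containing a relative interior point of a subset contains the whole subset, so every
  convex neighbourhood of \<open>x\<close> in some flat bounds the dimension of the face of \<open>x\<close> from below.\<close>

lemma aff_dim_le_face_through:
  fixes K :: "'a::euclidean_space set"
  assumes "convex K" "C \<subseteq> K" "x \<in> rel_interior C"
  shows "aff_dim C \<le> aff_dim (face_through K x)"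
proof -
  have "x \<in> C" using assms(3) rel_interior_subset by blast
  then have "x \<in> K" using assms(2) by blast
  note F = face_through[OF assms(1) this]
  have "x \<in> face_through K x" using F(2) rel_interior_subset by blast
  then have "C \<subseteq> face_through K x"
    using subset_of_face_of[OF F(1) assms(2)] assms(3) by blast
  then show ?thesis by (rule aff_dim_subset)
qed

lemma skeleton_nonempty:
  fixes K :: "'a::euclidean_space set"
  assumes "compact K" "convex K" "K \<noteq> {}"
  shows "skeleton k K \<noteq> {}"
proof -
  obtain x where x: "x extreme_point_of K"
    using extreme_point_exists_convex[OF assms] .
  then have xK: "x \<in> K" by (simp add: extreme_point_of_def)
  have "{x} face_of K" using x by (simp add: face_of_singleton)
  moreover have "x \<in> rel_interior {x}" by simp
  ultimately have "face_through K x = {x}"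
    unfolding face_through_def using ex1_face_through[OF assms(2) xK] by (intro the1_equality) auto
  then have "x \<in> skeleton k K" using xK by (simp add: skeleton_def k_extreme_def)
  then show ?thesis by blast
qed

text \<open>The level hyperplane through \<open>x\<^sub>0\<close>, cut down to the ball where \<open>f\<close> is affine, lies in the
  sublevel set. No distinction between \<open>f x\<^sub>0 < \<alpha>\<close> and \<open>f x\<^sub>0 = \<alpha>\<close> arises, and for \<open>a = 0\<close> the
  hyperplane is merely replaced by the whole space.\<close>

lemma locally_affine_not_skeleton:
  fixes f :: "'a::euclidean_space \<Rightarrow> real"
  assumes conv: "convex {x. f x \<le> \<alpha>}" and le: "f x\<^sub>0 \<le> \<alpha>" and dim: "DIM('a) \<ge> 2"
    and aff: "\<forall>\<^sub>F x in nhds x\<^sub>0. f x = a \<bullet> x + b"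
  shows "x\<^sub>0 \<notin> skeleton (DIM('a) - 2) {x. f x \<le> \<alpha>}"
proof
  assume sk: "x\<^sub>0 \<in> skeleton (DIM('a) - 2) {x. f x \<le> \<alpha>}"
  obtain e where e: "e > 0" "\<And>x. dist x x\<^sub>0 < e \<Longrightarrow> f x = a \<bullet> x + b"
    using aff unfolding eventually_nhds_metric by blast
  define H where "H = {x. a \<bullet> x = a \<bullet> x\<^sub>0}"
  define C where "C = ball x\<^sub>0 e \<inter> H"
  have H: "convex H" "affine H" "x\<^sub>0 \<in> H"
    unfolding H_def by (auto intro: convex_hyperplane affine_hyperplane)
  have x0: "x\<^sub>0 \<in> ball x\<^sub>0 e" using e(1) by simp
  then have ne: "ball x\<^sub>0 e \<inter> H \<noteq> {}" using H by blast
  have "aff_dim C = aff_dim H"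
    unfolding C_def Int_commute[of _ H] using H ne by (intro aff_dim_convex_Int_open) (simp_all add: Int_commute)
  moreover have "aff_dim H \<ge> int DIM('a) - 1"
    unfolding H_def by (cases "a = 0") auto
  moreover have "x\<^sub>0 \<in> rel_interior C"
    unfolding C_def using H x0 ne
    by (subst convex_affine_rel_interior_Int) (auto simp: rel_interior_open)
  moreover have "C \<subseteq> {x. f x \<le> \<alpha>}"
  proof
    fix x assume "x \<in> C"
    then have "dist x x\<^sub>0 < e" "a \<bullet> x = a \<bullet> x\<^sub>0" by (auto simp: C_def H_def dist_commute)
    then have "f x = f x\<^sub>0" using e(2)[of x] e(2)[of x\<^sub>0] e(1) by simp
    then show "x \<in> {x. f x \<le> \<alpha>}" using le by simp
  qed
  ultimately have "int DIM('a) - 1 \<le> aff_dim (face_through {x. f x \<le> \<alpha>} x\<^sub>0)"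
    using aff_dim_le_face_through[OF conv, of C x\<^sub>0] by simp
  then show False using sk dim by (auto simp: skeleton_def k_extreme_def)
qed

section \<open>Gauges\<close>

lemma gauge_fun_nonneg: "gauge_fun g \<Longrightarrow> 0 \<le> g x"
  and gauge_fun_eq_0D: "gauge_fun g \<Longrightarrow> g x = 0 \<Longrightarrow> x = 0"
  and gauge_fun_scaleR: "gauge_fun g \<Longrightarrow> 0 \<le> l \<Longrightarrow> g (l *\<^sub>R x) = l * g x"
  and gauge_fun_add: "gauge_fun g \<Longrightarrow> g (x + y) \<le> g x + g y"
  by (auto simp: gauge_fun_def)

lemma gauge_fun_zero: "gauge_fun g \<Longrightarrow> g 0 = 0"
  using gauge_fun_scaleR[of g 0 0] by simp

lemma gauge_fun_pos: "gauge_fun g \<Longrightarrow> x \<noteq> 0 \<Longrightarrow> 0 < g x"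
  using gauge_fun_nonneg[of g x] gauge_fun_eq_0D[of g x] by linarith

lemma gauge_fun_reflect:
  assumes "gauge_fun g"
  shows "gauge_fun (\<lambda>x. g (- x))"
  unfolding gauge_fun_def
proof (intro conjI allI impI)
  fix x y and l :: real
  show "0 \<le> g (- x)" using assms by (rule gauge_fun_nonneg)
  show "x = 0" if "g (- x) = 0" using gauge_fun_eq_0D[OF assms that] by simp
  show "g (- (l *\<^sub>R x)) = l * g (- x)" if "0 \<le> l"
    using gauge_fun_scaleR[OF assms that, of "- x"] by simp
  show "g (- (x + y)) \<le> g (- x) + g (- y)" using gauge_fun_add[OF assms, of "- x" "- y"] by simp
qed

lemma uminus_gauge_ball: "uminus ` gauge_ball g = gauge_ball (\<lambda>x. g (- x))"
proof
  show "gauge_ball (\<lambda>x. g (- x)) \<subseteq> uminus ` gauge_ball g"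
  proof
    fix x assume "x \<in> gauge_ball (\<lambda>x. g (- x))"
    then have "- x \<in> gauge_ball g" by (simp add: gauge_ball_def)
    then show "x \<in> uminus ` gauge_ball g" by (rule rev_image_eqI) simp
  qed
qed (auto simp: gauge_ball_def)

lemma gauge_fun_convex_on:
  assumes "gauge_fun g"
  shows "convex_on UNIV g"
proof (rule convex_onI)
  fix t :: real and x y assume t: "0 < t" "t < 1"
  show "g ((1 - t) *\<^sub>R x + t *\<^sub>R y) \<le> (1 - t) * g x + t * g y"
    using gauge_fun_add[OF assms, of "(1 - t) *\<^sub>R x" "t *\<^sub>R y"] t
    by (simp add: gauge_fun_scaleR[OF assms])
qed simp

lemma convex_sublevel_set:
  assumes "convex_on UNIV f"
  shows "convex {x. f x \<le> c}"
proof (rule convexI)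
  fix x y and u v :: real
  assume xy: "x \<in> {x. f x \<le> c}" "y \<in> {x. f x \<le> c}" and uv: "0 \<le> u" "0 \<le> v" "u + v = 1"
  have "f (u *\<^sub>R x + v *\<^sub>R y) \<le> u * f x + v * f y"
    using assms uv unfolding convex_on_def by blast
  also have "\<dots> \<le> c" using xy uv by (intro convex_bound_le) auto
  finally show "u *\<^sub>R x + v *\<^sub>R y \<in> {x. f x \<le> c}" by simp
qed

lemma convex_gauge_ball: "gauge_fun g \<Longrightarrow> convex (gauge_ball g)"
  unfolding gauge_ball_def by (intro convex_sublevel_set gauge_fun_convex_on)

lemma gauge_fun_continuous_on:
  fixes g :: "'a::euclidean_space \<Rightarrow> real"
  assumes "gauge_fun g"
  shows "continuous_on S g"
  using convex_on_continuous[OF open_UNIV gauge_fun_convex_on[OF assms]] continuous_on_subset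
  by blast

lemma zero_in_interior_gauge_ball:
  fixes g :: "'a::euclidean_space \<Rightarrow> real"
  assumes "gauge_fun g"
  shows "0 \<in> interior (gauge_ball g)"
proof (rule interiorI)
  show "open {x. g x < 1}"
    by (intro open_Collect_less gauge_fun_continuous_on assms continuous_intros)
qed (auto simp: gauge_ball_def gauge_fun_zero[OF assms])

text \<open>The minimum of \<open>g\<close> on the Euclidean unit sphere is positive, hence \<open>g\<close> dominates a multiple of
  the norm.\<close>

lemma compact_gauge_ball:
  fixes g :: "'a::euclidean_space \<Rightarrow> real"
  assumes "gauge_fun g"
  shows "compact (gauge_ball g)"
proof -
  obtain s :: 'a where s: "s \<in> sphere 0 1" and min: "\<And>x. x \<in> sphere 0 1 \<Longrightarrow> g s \<le> g x"
    using continuous_attains_inf[of "sphere 0 1" g] gauge_fun_continuous_on[OF assms] by auto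
  have "s \<noteq> 0" using s by auto
  then have pos: "0 < g s" by (rule gauge_fun_pos[OF assms])
  have "norm x \<le> 1 / g s" if "x \<in> gauge_ball g" for x
  proof (cases "x = 0")
    case False
    have "g s \<le> g ((1 / norm x) *\<^sub>R x)" using False by (intro min) simp
    also have "\<dots> = g x / norm x" by (simp add: gauge_fun_scaleR[OF assms])
    also have "\<dots> \<le> 1 / norm x" using that False by (simp add: gauge_ball_def divide_right_mono)
    finally show ?thesis using False pos by (simp add: field_simps)
  qed (use pos in simp)
  then have "bounded (gauge_ball g)" unfolding bounded_iff by blast
  moreover have "closed (gauge_ball g)"
    unfolding gauge_ball_def by (intro closed_Collect_le gauge_fun_continuous_on assms continuous_intros)
  ultimately show ?thesis by (simp add: compact_eq_bounded_closed)
qed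

text \<open>A Hahn--Banach functional, obtained as a supporting hyperplane of the unit ball: it can be
  normalised to the value \<open>1\<close> at \<open>u\<close> because \<open>0\<close> is an interior point.\<close>

lemma gauge_supporting_functional:
  fixes g :: "'a::euclidean_space \<Rightarrow> real"
  assumes g: "gauge_fun g" and u: "g u = 1"
  obtains a where "a \<bullet> u = 1" "\<And>z. a \<bullet> z \<le> g z"
proof -
  let ?B = "gauge_ball g"
  have uB: "u \<in> ?B" using u by (simp add: gauge_ball_def)
  have 0: "0 \<in> rel_interior ?B"
    using zero_in_interior_gauge_ball[OF g] interior_subset_rel_interior by blast
  have "u \<notin> rel_interior ?B"
  proof
    assume "u \<in> rel_interior ?B"
    moreover have "0 \<in> affine hull ?B" by (simp add: hull_inc gauge_ball_def gauge_fun_zero[OF g])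
    ultimately obtain m where "m > 1" "(1 - m) *\<^sub>R 0 + m *\<^sub>R u \<in> ?B"
      by (metis convex_rel_interior_if2[OF convex_gauge_ball[OF g]])
    then show False using u by (simp add: gauge_ball_def gauge_fun_scaleR[OF g])
  qed
  moreover have "u \<in> closure ?B" using uB closure_subset by blast
  ultimately obtain b where b': "\<And>y. y \<in> closure ?B \<Longrightarrow> b \<bullet> u \<le> b \<bullet> y"
    and b'': "\<And>y. y \<in> rel_interior ?B \<Longrightarrow> b \<bullet> u < b \<bullet> y"
    using supporting_hyperplane_relative_frontier[OF convex_gauge_ball[OF g]] by metis
  have b: "b \<bullet> u \<le> b \<bullet> y" if "y \<in> ?B" for y using b' that closure_subset by blast
  define a where "a = (1 / (b \<bullet> u)) *\<^sub>R b"
  have neg: "b \<bullet> u < 0" using b''[OF 0] by simp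
  show thesis
  proof
    show "a \<bullet> u = 1" using neg by (simp add: a_def)
    fix z
    show "a \<bullet> z \<le> g z"
    proof (cases "z = 0")
      case False
      have pos: "0 < g z" using gauge_fun_pos[OF g False] .
      have "(1 / g z) *\<^sub>R z \<in> ?B" using pos by (simp add: gauge_ball_def gauge_fun_scaleR[OF g])
      from b[OF this] have "(b \<bullet> u) * g z \<le> b \<bullet> z" using pos by (simp add: field_simps)
      then show ?thesis using neg by (simp add: a_def field_simps)
    qed (simp add: gauge_fun_zero[OF g])
  qed
qed

text \<open>The face of \<open>u = y / g y\<close> lies in a supporting hyperplane \<open>{z. a \<bullet> z = 1}\<close>, and having dimension
  \<open>d - 1\<close> it fills a neighbourhood of \<open>u\<close> there. So \<open>g = 1\<close> on that neighbourhood, and by positive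
  homogeneity \<open>g\<close> agrees with \<open>a\<close> on the cone over it, which is a neighbourhood of \<open>y\<close>.\<close>

lemma gauge_linear_near_non_skeleton:
  fixes g :: "'a::euclidean_space \<Rightarrow> real"
  assumes g: "gauge_fun g" and y: "y \<noteq> 0" and dim: "DIM('a) \<ge> 2"
    and nsk: "(1 / g y) *\<^sub>R y \<notin> skeleton (DIM('a) - 2) (gauge_ball g)"
  obtains a where "\<forall>\<^sub>F z in nhds y. g z = a \<bullet> z"
proof -
  let ?B = "gauge_ball g"
  define u where "u = (1 / g y) *\<^sub>R y"
  have gy: "0 < g y" using gauge_fun_pos[OF g y] .
  have gu: "g u = 1" using gy by (simp add: u_def gauge_fun_scaleR[OF g])
  then have uB: "u \<in> ?B" by (simp add: gauge_ball_def)
  obtain a where au: "a \<bullet> u = 1" and a: "\<And>z. a \<bullet> z \<le> g z"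
    using gauge_supporting_functional[OF g gu] by blast
  define H where "H = {z. a \<bullet> z = 1}"
  define F where "F = face_through ?B u"
  have F: "F face_of ?B" "u \<in> rel_interior F"
    unfolding F_def using face_through[OF convex_gauge_ball[OF g] uB] by auto
  have FB: "F \<subseteq> ?B" using F(1) by (rule face_of_imp_subset)

  have "a \<bullet> z \<le> 1" if "z \<in> ?B" for z
    using a[of z] that by (simp add: gauge_ball_def)
  then have "(?B \<inter> H) face_of ?B"
    unfolding H_def by (intro face_of_Int_supporting_hyperplane_le convex_gauge_ball[OF g])
  moreover have "(?B \<inter> H) \<inter> rel_interior F \<noteq> {}"
    using uB au F(2) by (auto simp: H_def)
  ultimately have FH: "F \<subseteq> H" using subset_of_face_of[OF _ FB] by blast

  have "aff_dim F > int (DIM('a) - 2)"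
    using nsk uB unfolding u_def[symmetric] F_def by (simp add: skeleton_def k_extreme_def)
  moreover have "aff_dim H = int DIM('a) - 1"
    using au unfolding H_def by (subst aff_dim_hyperplane) auto
  moreover have "aff_dim F \<le> aff_dim H" using FH by (rule aff_dim_subset)
  ultimately have "aff_dim F = aff_dim H" using dim by linarith
  then have "affine hull F = affine hull H" using aff_dim_eq_full_gen[OF FH] by blast
  also have "\<dots> = H" unfolding H_def by (simp add: affine_hyperplane affine_hull_eq)
  finally obtain T where T: "open T" "u \<in> T" "T \<inter> H \<subseteq> F"
    using F(2) unfolding mem_rel_interior by auto

  have ay: "a \<bullet> y = g y" using au gy by (simp add: u_def)
  have "\<forall>\<^sub>F z in nhds y. g z = a \<bullet> z"
  proof -
    have lim: "((\<lambda>z. a \<bullet> z) \<longlongrightarrow> a \<bullet> y) (nhds y)"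
      by (intro tendsto_intros filterlim_ident)
    then have "((\<lambda>z. (1 / (a \<bullet> z)) *\<^sub>R z) \<longlongrightarrow> (1 / (a \<bullet> y)) *\<^sub>R y) (nhds y)"
      using ay gy by (intro tendsto_intros filterlim_ident) auto
    then have "\<forall>\<^sub>F z in nhds y. (1 / (a \<bullet> z)) *\<^sub>R z \<in> T"
      using T by (auto simp: ay u_def dest: topological_tendstoD)
    moreover have "\<forall>\<^sub>F z in nhds y. a \<bullet> z > 0"
      using order_tendstoD(1)[OF lim, of 0] ay gy by simp
    ultimately show ?thesis
    proof eventually_elim
      case (elim z)
      have "(1 / (a \<bullet> z)) *\<^sub>R z \<in> ?B"
        using elim T(3) FB by (force simp: H_def)
      then have "g z \<le> a \<bullet> z"
        using elim(2) by (simp add: gauge_ball_def gauge_fun_scaleR[OF g] field_simps)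
      then show ?case using a[of z] by simp
    qed
  qed
  then show thesis by (rule that)
qed

section \<open>Sublevel sets of sums of gauges\<close>

lemma convex_sublevel_sum_gauges:
  fixes p :: "'i \<Rightarrow> 'a::real_vector"
  assumes "\<And>i. i \<in> I \<Longrightarrow> gauge_fun (\<gamma> i)"
  shows "convex {x. (\<Sum>i\<in>I. \<gamma> i (p i - x)) \<le> \<alpha>}"
proof -
  have "convex_on UNIV (\<lambda>x. \<Sum>i\<in>I. \<gamma> i (p i - x))"
  proof (rule convex_onI)
    fix t :: real and x y :: 'a assume t: "0 < t" "t < 1"
    have "\<gamma> i (p i - ((1 - t) *\<^sub>R x + t *\<^sub>R y)) \<le> (1 - t) * \<gamma> i (p i - x) + t * \<gamma> i (p i - y)"
      if "i \<in> I" for i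
    proof -
      have "p i - ((1 - t) *\<^sub>R x + t *\<^sub>R y) = (1 - t) *\<^sub>R (p i - x) + t *\<^sub>R (p i - y)"
        by (simp add: algebra_simps)
      then show ?thesis
        using convex_onD[OF gauge_fun_convex_on[OF assms[OF that]], of t "p i - x" "p i - y"] t
        by simp
    qed
    then show "(\<Sum>i\<in>I. \<gamma> i (p i - ((1 - t) *\<^sub>R x + t *\<^sub>R y)))
        \<le> (1 - t) * (\<Sum>i\<in>I. \<gamma> i (p i - x)) + t * (\<Sum>i\<in>I. \<gamma> i (p i - y))"
      unfolding sum_distrib_left sum.distrib[symmetric] by (rule sum_mono)
  qed simp
  then show ?thesis by (rule convex_sublevel_set)
qed

theorem proposition3p8:
  fixes p :: "nat \<Rightarrow> real ^ 'd"
    and \<gamma> :: "nat \<Rightarrow> real ^ 'd \<Rightarrow> real"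
    and f :: "real ^ 'd \<Rightarrow> real"
    and n :: nat
    and \<alpha> :: real
    and x\<^sub>0 :: "real ^ 'd"
  assumes "CARD('d) \<ge> 2"
    and "n \<ge> 1"
    and "\<And>i. i \<in> {1..n} \<Longrightarrow> gauge_fun (\<gamma> i)"
    and "\<And>x. f x = (\<Sum>i = 1..n. \<gamma> i (p i - x))"
    and "x\<^sub>0 \<in> skeleton (CARD('d) - 2) {x. f x \<le> \<alpha>}"
  shows "\<exists>i\<in>{1..n}. \<exists>l\<in>{0..\<alpha>}. \<exists>w \<in> skeleton (CARD('d) - 2) (uminus ` gauge_ball (\<gamma> i)).
           x\<^sub>0 = p i + l *\<^sub>R w"
proof -
  have dim_eq: "DIM(real ^ 'd) = CARD('d)" by simp
  have dim: "2 \<le> DIM(real ^ 'd)" unfolding dim_eq by (rule assms(1))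
  have f_eq: "f = (\<lambda>x. \<Sum>i = 1..n. \<gamma> i (p i - x))" using assms(4) by blast
  have fx: "f x\<^sub>0 \<le> \<alpha>" using assms(5) by (simp add: skeleton_def k_extreme_def)
  have conv: "convex {x. f x \<le> \<alpha>}"
    unfolding f_eq using assms(3) by (rule convex_sublevel_sum_gauges)
  \<comment> \<open>the gauge whose unit ball is \<open>- B\<^sub>i\<close>\<close>
  define h where "h i x = \<gamma> i (- x)" for i x
  have h: "gauge_fun (h i)" if "i \<in> {1..n}" for i
    unfolding h_def using gauge_fun_reflect[OF assms(3)[OF that]] .
  have ball: "uminus ` gauge_ball (\<gamma> i) = gauge_ball (h i)" for i
    unfolding h_def by (rule uminus_gauge_ball)
  have bound: "h i (x\<^sub>0 - p i) \<in> {0..\<alpha>}" if "i \<in> {1..n}" for i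
  proof -
    have "h i (x\<^sub>0 - p i) \<le> f x\<^sub>0"
      unfolding f_eq h_def minus_diff_eq
      using that assms(3) by (intro member_le_sum) (auto intro: gauge_fun_nonneg)
    then show ?thesis using fx gauge_fun_nonneg[OF h[OF that]] by auto
  qed
  show ?thesis
  proof (cases "\<exists>i\<in>{1..n}. x\<^sub>0 = p i")
    case True
    then obtain i where i: "i \<in> {1..n}" "x\<^sub>0 = p i" by blast
    have "0 \<in> gauge_ball (h i)"
      using gauge_fun_zero[OF h[OF i(1)]] by (simp add: gauge_ball_def)
    then have "gauge_ball (h i) \<noteq> {}" by blast
    then obtain w where "w \<in> skeleton (CARD('d) - 2) (gauge_ball (h i))"
      using skeleton_nonempty[OF compact_gauge_ball convex_gauge_ball] h[OF i(1)] by blast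
    moreover have "0 \<in> {0..\<alpha>}" using bound[OF i(1)] by auto
    moreover have "x\<^sub>0 = p i + 0 *\<^sub>R w" using i(2) by simp
    ultimately show ?thesis unfolding ball using i(1) by blast
  next
    case False
    show ?thesis
    proof (rule ccontr)
      assume contra: "\<not> ?thesis"
      have "\<exists>a. \<forall>\<^sub>F x in nhds x\<^sub>0. \<gamma> i (p i - x) = a \<bullet> (x - p i)" if i: "i \<in> {1..n}" for i
      proof -
        define y where "y = x\<^sub>0 - p i"
        have y: "y \<noteq> 0" using False i by (auto simp: y_def)
        have "x\<^sub>0 = p i + h i y *\<^sub>R ((1 / h i y) *\<^sub>R y)"
          using gauge_fun_pos[OF h[OF i] y] unfolding y_def by simp
        moreover have "h i y \<in> {0..\<alpha>}" unfolding y_def by (rule bound[OF i])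
        ultimately have "(1 / h i y) *\<^sub>R y \<notin> skeleton (DIM(real ^ 'd) - 2) (gauge_ball (h i))"
          using contra i unfolding ball dim_eq by blast
        then obtain a where a: "\<forall>\<^sub>F z in nhds y. h i z = a \<bullet> z"
          using gauge_linear_near_non_skeleton[OF h[OF i] y dim] by blast
        have "((\<lambda>x. x - p i) \<longlongrightarrow> x\<^sub>0 - p i) (nhds x\<^sub>0)"
          by (intro tendsto_intros filterlim_ident)
        then have "\<forall>\<^sub>F x in nhds x\<^sub>0. h i (x - p i) = a \<bullet> (x - p i)"
          using a unfolding y_def by (rule eventually_compose_filterlim[rotated])
        then show ?thesis unfolding h_def by auto
      qed
      then obtain a where a:
        "\<And>i. i \<in> {1..n} \<Longrightarrow> \<forall>\<^sub>F x in nhds x\<^sub>0. \<gamma> i (p i - x) = a i \<bullet> (x - p i)"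
        by metis
      then have "\<forall>\<^sub>F x in nhds x\<^sub>0. \<forall>i\<in>{1..n}. \<gamma> i (p i - x) = a i \<bullet> (x - p i)"
        by (intro eventually_ball_finite) auto
      then have "\<forall>\<^sub>F x in nhds x\<^sub>0. f x = (\<Sum>i = 1..n. a i) \<bullet> x + (- (\<Sum>i = 1..n. a i \<bullet> p i))"
        by eventually_elim (simp add: f_eq inner_diff_right sum_subtractf inner_sum_left)
      from locally_affine_not_skeleton[OF conv fx dim this] show False using assms(5) by simp
    qed
  qed
qed

end
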